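(* Let $\mu$ be a nonzero bounded positive Borel measure on $\mathbb{R}$. Then $P^d_\lambda<\infty$ for every $\lambda>0$. If in addition $\mu$ has bounded support, then for every $\lambda>0$ there exists $f\in l^2(\mathbb{Z})$ with $\|f\|_{l^2}^2=\lambda$ and $\mathcal{Q}^d_\mu(f,f,f,f)=P^d_\lambda$, and any such maximizer satisfies, with $\omega=P^d_\lambda/\lambda>0$, $$\omega\langle g,f\rangle=\mathcal{Q}^d_\mu(g,f,f,f)\quad\text{for all } g\in l^2(\mathbb{Z}).$$
   Context: Let $\Delta$ be the discrete Laplacian on $l^2(\mathbb{Z})$, $(\Delta f)(x)=f(x+1)+f(x-1)-2f(x)$, and $S_r=e^{ir\Delta}$ ($r\in\mathbb{R}$). For a positive Borel measure $\mu$ on $\mathbb{R}$ and $f_1,\dots,f_4\in l^2(\mathbb{Z})$ define $$\mathcal{Q}^d_\mu(f_1,f_2,f_3,f_4)=\sum_{x\in\mathbb{Z}}\int_{\mathbb{R}}\overline{(S_rf_1)(x)}\,(S_rf_2)(x)\,\overline{(S_rf_3)(x)}\,(S_rf_4)(x)\,\mu(dr),$$ and $P^d_\lambda=\sup\{\mathcal{Q}^d_\mu(f,f,f,f): f\in l^2(\mathbb{Z}),\ \|f\|_{l^2}^2=\lambda\}$. The inner product is $\langle g,f\rangle=\sum_x\overline{g(x)}f(x)$. *)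

theory Defs
  imports "HOL-Analysis.Analysis"
begin

definition is_l2 :: "(int \<Rightarrow> complex) \<Rightarrow> bool" where
  "is_l2 f \<longleftrightarrow> (\<lambda>x. (norm (f x))\<^sup>2) summable_on UNIV"

definition l2_norm_sq :: "(int \<Rightarrow> complex) \<Rightarrow> real" where
  "l2_norm_sq f = (\<Sum>\<^sub>\<infinity>x. (norm (f x))\<^sup>2)"

definition l2_inner :: "(int \<Rightarrow> complex) \<Rightarrow> (int \<Rightarrow> complex) \<Rightarrow> complex" where
  "l2_inner g f = (\<Sum>\<^sub>\<infinity>x. cnj (g x) * f x)"

definition dlap :: "(int \<Rightarrow> complex) \<Rightarrow> int \<Rightarrow> complex" where
  "dlap f x = f (x + 1) + f (x - 1) - 2 * f x"

text \<open>S_r = exp(i r Delta), defined by the exponential series of the bounded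
  operator Delta (which converges in operator norm), evaluated pointwise.\<close>
definition Sr :: "real \<Rightarrow> (int \<Rightarrow> complex) \<Rightarrow> int \<Rightarrow> complex" where
  "Sr r f x = (\<Sum>n. (\<i> * complex_of_real r) ^ n / fact n * (dlap ^^ n) f x)"

definition Qd :: "real measure \<Rightarrow> (int \<Rightarrow> complex) \<Rightarrow> (int \<Rightarrow> complex) \<Rightarrow>
    (int \<Rightarrow> complex) \<Rightarrow> (int \<Rightarrow> complex) \<Rightarrow> complex" where
  "Qd \<mu> f1 f2 f3 f4 = (\<Sum>\<^sub>\<infinity>x. (LINT r|\<mu>.
      cnj (Sr r f1 x) * Sr r f2 x * cnj (Sr r f3 x) * Sr r f4 x))"

text \<open>The diagonal Q^d_mu(f,f,f,f): its integrand is |S_r f(x)|^4 >= 0, so it is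
  taken as a sum/integral of nonnegative terms in [0,\<infinity>] (no junk values).\<close>
definition Qd_diag :: "real measure \<Rightarrow> (int \<Rightarrow> complex) \<Rightarrow> ennreal" where
  "Qd_diag \<mu> f = (\<integral>\<^sup>+ x. (\<integral>\<^sup>+ r. ennreal ((norm (Sr r f x)) ^ 4) \<partial>\<mu>) \<partial>count_space UNIV)"

definition Pd :: "real measure \<Rightarrow> real \<Rightarrow> ennreal" where
  "Pd \<mu> lam = (SUP f \<in> {f. is_l2 f \<and> l2_norm_sq f = lam}. Qd_diag \<mu> f)"

end

theory Submission
  imports Defs "HOL-Complex_Analysis.Great_Picard"
begin

text \<open>The flow \<open>S_r\<close> contracts \<open>l\<^sup>2\<close> (Euler steps \<open>(1 + i r \<Delta>/N)\<^sup>N\<close> multiply the squared norm by at most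
  \<open>(1 + 16 r\<^sup>2/N\<^sup>2)\<^sup>N\<close>), which makes \<open>P\<^sub>\<lambda>\<close> finite. It is also bounded by \<open>exp (4 |r|)\<close> on \<open>l\<^sup>\<infinity>\<close>, so for
  compactly supported \<open>\<mu>\<close> the terms of a maximizing sequence have a value bounded away from 0; after translation
  and passing to a subsequence it converges pointwise to some \<open>f \<noteq> 0\<close>.
  The diagonal form \<open>Q\<close> is convex and bounded by \<open>P\<^sub>\<lambda>/\<lambda>\<^sup>2 \<parallel>h\<parallel>\<^sup>4\<close>, so comparing the tangent of \<open>Q\<close> at
  \<open>f\<^sub>n\<close> with this quartic bound and letting \<open>n\<close> tend to infinity yields the Euler--Lagrange equation for \<open>f\<close>,
  without knowing that no mass was lost. Testing it with \<open>f\<close> itself gives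
  \<open>\<omega> \<parallel>f\<parallel>\<^sup>2 = Q(f) \<le> \<omega> \<parallel>f\<parallel>\<^sup>4/\<lambda>\<close>, hence \<open>\<parallel>f\<parallel>\<^sup>2 \<ge> \<lambda>\<close> and \<open>f\<close> is a maximizer. The constant sequence gives the
  equation for any maximizer.\<close>

subsection \<open>Square-summable sequences\<close>

text \<open>A substitute for dominated convergence when the terms have no common summable majorant
  because part of the mass may move off to infinity. The moving part \<open>H n\<close> has total at
  most \<open>C\<close> and carries the factor \<open>e\<close>, so it is uniformly small; the fixed
  part \<open>G\<close> has small tails even after division by \<open>e\<close>.\<close>

lemma infsum_tendsto_of_weighted_bound:
  fixes q :: "nat \<Rightarrow> 'a \<Rightarrow> complex" and H :: "nat \<Rightarrow> 'a \<Rightarrow> real" and G :: "'a \<Rightarrow> real"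
  assumes lim: "\<And>x. (\<lambda>n. q n x) \<longlonglongrightarrow> q' x"
    and bound: "\<And>e n x. e > 0 \<Longrightarrow> norm (q n x) \<le> e * H n x + G x / e"
    and H0: "\<And>n x. 0 \<le> H n x" and G0: "\<And>x. 0 \<le> G x"
    and HS: "\<And>n. H n summable_on UNIV" and HC: "\<And>n. infsum (H n) UNIV \<le> C"
    and GS: "G summable_on UNIV"
  shows "(\<lambda>n. infsum (q n) UNIV) \<longlonglongrightarrow> infsum q' UNIV"
proof -
  have HF: "sum (H n) F \<le> C" if "finite F" for n F
    using finite_sum_le_infsum[OF HS that] H0 HC[of n] by (force intro: order_trans)
  have HSA: "H n summable_on A" and GSA: "G summable_on A" for n A
    using summable_on_subset_banach[OF HS] summable_on_subset_banach[OF GS] by blast+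
  have HA: "infsum (H n) A \<le> C" for n A
    by (rule infsum_le_finite_sums[OF HSA]) (use HF in blast)
  have C0: "0 \<le> C"
    using HF[of "{}"] by simp
  have bsum: "(\<lambda>x. e * H n x + G x / e) summable_on A" for e n A
    unfolding divide_inverse by (intro summable_on_add summable_on_cmult_right summable_on_cmult_left HSA GSA)
  have absq: "(\<lambda>x. norm (q n x)) summable_on A" for n A
    by (rule Infinite_Sum.abs_summable_on_comparison_test'[OF bsum[of 1 n]]) (use bound[of 1 n] in simp)
  \<comment> \<open>Bounds over finite sets pass to the pointwise limit; from them come both the
    absolute summability and the tail bound of \<open>q'\<close>.\<close>
  have fin': "(\<Sum>x\<in>F. norm (q' x)) \<le> e * C + sum G F / e" if "finite F" "e > 0" for e F
  proof (rule LIMSEQ_le_const2)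
    show "(\<lambda>n. \<Sum>x\<in>F. norm (q n x)) \<longlonglongrightarrow> (\<Sum>x\<in>F. norm (q' x))"
      by (intro tendsto_intros lim)
    have "(\<Sum>x\<in>F. norm (q n x)) \<le> e * C + sum G F / e" for n
    proof -
      have "(\<Sum>x\<in>F. norm (q n x)) \<le> (\<Sum>x\<in>F. e * H n x + G x / e)"
        by (intro sum_mono bound that)
      also have "\<dots> = e * sum (H n) F + sum G F / e"
        by (simp add: sum.distrib sum_distrib_left sum_divide_distrib)
      finally show ?thesis
        using mult_left_mono[OF HF[OF that(1), of n], of e] that by linarith
    qed
    then show "\<exists>N. \<forall>n\<ge>N. (\<Sum>x\<in>F. norm (q n x)) \<le> e * C + sum G F / e" by blast
  qed
  have absq': "(\<lambda>x. norm (q' x)) summable_on A" for A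
  proof (rule nonneg_bdd_above_summable_on)
    show "bdd_above (sum (\<lambda>x. norm (q' x)) ` {F. F \<subseteq> A \<and> finite F})"
    proof (rule bdd_aboveI2)
      fix F assume "F \<in> {F. F \<subseteq> A \<and> finite F}"
      then have F: "finite F" by simp
      show "(\<Sum>x\<in>F. norm (q' x)) \<le> C + infsum G UNIV"
        using fin'[OF F, of 1] finite_sum_le_infsum[OF GS F] G0 by force
    qed
  qed simp
  have tail: "norm (infsum (q n) A) \<le> e * C + infsum G A / e" if "e > 0" for n A e
  proof -
    have "norm (infsum (q n) A) \<le> infsum (\<lambda>x. norm (q n x)) A"
      by (rule norm_infsum_bound[OF absq])
    also have "\<dots> \<le> infsum (\<lambda>x. e * H n x + G x / e) A"
      by (intro infsum_mono absq bsum bound that)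
    also have "\<dots> = e * infsum (H n) A + infsum G A / e"
      unfolding divide_inverse
      by (subst infsum_add)
        (simp_all add: summable_on_cmult_right summable_on_cmult_left HSA GSA
           infsum_cmult_right' infsum_cmult_left')
    finally show ?thesis
      using mult_left_mono[OF HA[of n A], of e] that by linarith
  qed
  have tail': "norm (infsum q' A) \<le> e * C + infsum G A / e" if "e > 0" for A e
  proof -
    have "norm (infsum q' A) \<le> infsum (\<lambda>x. norm (q' x)) A"
      by (rule norm_infsum_bound[OF absq'])
    also have "\<dots> \<le> e * C + infsum G A / e"
    proof (rule infsum_le_finite_sums[OF absq'])
      fix F assume F: "finite F" "F \<subseteq> A"
      have "sum G F / e \<le> infsum G A / e"
        using finite_sum_le_infsum[OF GSA F] G0 that by (auto intro: divide_right_mono)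
      then show "(\<Sum>x\<in>F. norm (q' x)) \<le> e * C + infsum G A / e"
        using fin'[OF F(1) that] by linarith
    qed
    finally show ?thesis .
  qed
  show ?thesis
  proof (rule LIMSEQ_I)
    fix d :: real assume d: "d > 0"
    \<comment> \<open>The order of choice matters: first \<open>e\<close>, making the moving part at
      most \<open>d / 8\<close>; then \<open>F\<close>, depending on \<open>e\<close>, so that the
      tail of \<open>G\<close> divided by \<open>e\<close> is at most \<open>d / 8\<close>; last
      \<open>N\<close>. The three errors add up to less than \<open>3 * d / 4\<close>.\<close>
    define e where "e = d / (8 * (C + 1))"
    have e: "e > 0" "e * C \<le> d / 8"
      using d C0 by (auto simp: e_def field_simps)
    obtain F where F: "finite F" "dist (sum G F) (infsum G UNIV) \<le> e * d / 8"
      using infsum_finite_approximation[OF GS, of "e * d / 8"] e d by auto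
    have split: "infsum f UNIV = sum f F + infsum f (- F)" if "(\<lambda>x. norm (f x)) summable_on UNIV" for f :: "'a \<Rightarrow> complex"
      using infsum_Un_disjoint[of f F "-F"] F(1) abs_summable_summable[OF that]
        summable_on_subset_banach[OF abs_summable_summable[OF that], of "-F"] by auto
    have "infsum G UNIV = sum G F + infsum G (- F)"
      using infsum_Un_disjoint[of G F "-F"] F(1) GSA by auto
    then have "infsum G (- F) \<le> e * d / 8"
      using F(2) by (auto simp: dist_real_def)
    then have GT: "infsum G (- F) / e \<le> d / 8"
      using e by (simp add: field_simps)
    have "(\<lambda>n. sum (q n) F) \<longlonglongrightarrow> sum q' F"
      by (intro tendsto_intros lim)
    then obtain N where N: "\<And>n. n \<ge> N \<Longrightarrow> norm (sum (q n) F - sum q' F) < d / 4"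
      using LIMSEQ_D[of _ _ "d/4"] d by (metis zero_less_divide_iff zero_less_numeral)
    have "norm (infsum (q n) UNIV - infsum q' UNIV) < d" if "n \<ge> N" for n
    proof -
      have "infsum (q n) UNIV - infsum q' UNIV
          = (sum (q n) F - sum q' F) + infsum (q n) (-F) - infsum q' (-F)"
        unfolding split[OF absq] split[OF absq'] by simp
      also have "norm \<dots> \<le> norm (sum (q n) F - sum q' F) + norm (infsum (q n) (-F)) + norm (infsum q' (-F))"
        using norm_triangle_ineq4[of "sum (q n) F - sum q' F + infsum (q n) (-F)" "infsum q' (-F)"]
          norm_triangle_ineq[of "sum (q n) F - sum q' F" "infsum (q n) (-F)"] by linarith
      finally show ?thesis
        using N[OF that] tail[OF e(1), of n "-F"] tail'[OF e(1), of "-F"] GT e(2) d by linarith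
    qed
    then show "\<exists>N. \<forall>n\<ge>N. norm (infsum (q n) UNIV - infsum q' UNIV) < d" by blast
  qed
qed

text \<open>Young's inequality with a free weight, without its sharp constant; it produces the
  bounds required by \<open>infsum_tendsto_of_weighted_bound\<close>.\<close>

lemma mult_le_weighted_squares:
  fixes a b e :: real
  assumes "e > 0"
  shows "a * b \<le> e * a\<^sup>2 + b\<^sup>2 / e"
proof -
  have "0 \<le> (e * a - b)\<^sup>2 + (e*a)\<^sup>2 + b\<^sup>2" by simp
  then have "2 * (e * a * b) \<le> 2 * (e * (e * a\<^sup>2) + b\<^sup>2)"
    by (simp add: power2_eq_square algebra_simps)
  then show ?thesis
    using assms by (simp add: field_simps power2_eq_square)
qed

lemma is_l2_I:
  assumes "\<And>F. finite F \<Longrightarrow> (\<Sum>x\<in>F. (norm (f x))\<^sup>2) \<le> B"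
  shows "is_l2 f" "l2_norm_sq f \<le> B"
proof -
  show "is_l2 f"
    unfolding is_l2_def
    by (rule nonneg_bdd_above_summable_on) (use assms in \<open>auto intro!: bdd_aboveI2\<close>)
  then show "l2_norm_sq f \<le> B"
    unfolding l2_norm_sq_def is_l2_def by (rule infsum_le_finite_sums) (use assms in auto)
qed

lemma sum_le_l2_norm_sq:
  assumes "is_l2 f" "finite F"
  shows "(\<Sum>x\<in>F. (norm (f x))\<^sup>2) \<le> l2_norm_sq f"
  using assms unfolding l2_norm_sq_def is_l2_def by (auto intro: finite_sum_le_infsum)

lemma norm_sq_le_l2_norm_sq: "is_l2 f \<Longrightarrow> (norm (f x))\<^sup>2 \<le> l2_norm_sq f"
  using sum_le_l2_norm_sq[of f "{x}"] by simp

lemma norm_le_sqrt_l2_norm_sq: "is_l2 f \<Longrightarrow> norm (f x) \<le> sqrt (l2_norm_sq f)"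
  using norm_sq_le_l2_norm_sq[of f x] by (simp add: real_le_rsqrt)

lemma l2_norm_sq_nonneg: "0 \<le> l2_norm_sq f"
  unfolding l2_norm_sq_def by (intro infsum_nonneg) auto

text \<open>Fatou's lemma for sequences: each finite partial sum converges and stays below
  \<open>B n\<close>.\<close>

lemma is_l2_pointwise_limit:
  assumes "\<And>n. is_l2 (f n)" "\<And>n. l2_norm_sq (f n) \<le> B n" "B \<longlonglongrightarrow> C" "\<And>x. (\<lambda>n. f n x) \<longlonglongrightarrow> g x"
  shows "is_l2 g" "l2_norm_sq g \<le> C"
proof -
  have *: "(\<Sum>x\<in>F. (norm (g x))\<^sup>2) \<le> C" if "finite F" for F
  proof (rule LIMSEQ_le)
    show "(\<lambda>n. \<Sum>x\<in>F. (norm (f n x))\<^sup>2) \<longlonglongrightarrow> (\<Sum>x\<in>F. (norm (g x))\<^sup>2)"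
      by (intro tendsto_intros assms)
    show "\<exists>N. \<forall>n\<ge>N. (\<Sum>x\<in>F. (norm (f n x))\<^sup>2) \<le> B n"
      using sum_le_l2_norm_sq[OF assms(1) that] assms(2) by (metis order_trans)
  qed fact
  show "is_l2 g" "l2_norm_sq g \<le> C"
    using is_l2_I[of g C] * by auto
qed

lemma norm_cnj_mult_le:
  assumes "e > 0"
  shows "norm (cnj (a::complex) * b) \<le> e * (norm b)\<^sup>2 + (norm a)\<^sup>2 / e"
  using mult_le_weighted_squares[OF assms, of "norm b" "norm a"] by (simp add: norm_mult mult.commute)

lemma abs_summable_l2_inner:
  assumes "is_l2 f" "is_l2 g"
  shows "(\<lambda>x. norm (cnj (g x) * f x)) summable_on UNIV"
proof (rule Infinite_Sum.abs_summable_on_comparison_test')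
  show "(\<lambda>x. 1 * (norm (f x))\<^sup>2 + (norm (g x))\<^sup>2 / 1) summable_on UNIV"
    using assms unfolding is_l2_def by (auto intro: summable_on_add)
qed (rule norm_cnj_mult_le, simp)

lemma l2_norm_sq_add:
  assumes "is_l2 f" "is_l2 g"
  shows "is_l2 (\<lambda>x. f x + of_real t * g x)"
    and "l2_norm_sq (\<lambda>x. f x + of_real t * g x)
      = l2_norm_sq f + 2 * t * Re (l2_inner g f) + t\<^sup>2 * l2_norm_sq g"
proof -
  have i: "((\<lambda>x. cnj (g x) * f x) has_sum l2_inner g f) UNIV"
    unfolding l2_inner_def by (rule has_sum_infsum[OF abs_summable_summable[OF abs_summable_l2_inner[OF assms]]])
  have n: "((\<lambda>x. (norm (f x))\<^sup>2) has_sum l2_norm_sq f) UNIV" "((\<lambda>x. (norm (g x))\<^sup>2) has_sum l2_norm_sq g) UNIV"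
    unfolding l2_norm_sq_def using assms by (auto simp: is_l2_def)
  have e: "(norm (f x + of_real t * g x))\<^sup>2
    = (norm (f x))\<^sup>2 + 2 * t * Re (cnj (g x) * f x) + t\<^sup>2 * (norm (g x))\<^sup>2" for x
    by (simp only: cmod_power2 plus_complex.sel times_complex.sel cnj.sel Re_complex_of_real Im_complex_of_real) (simp add: power2_eq_square algebra_simps)
  have "((\<lambda>x. (norm (f x + of_real t * g x))\<^sup>2) has_sum
     (l2_norm_sq f + 2 * t * Re (l2_inner g f) + t\<^sup>2 * l2_norm_sq g)) UNIV"
    unfolding e by (rule has_sum_add[OF has_sum_add[OF n(1) has_sum_cmult_right[OF has_sum_Re[OF i]]] has_sum_cmult_right[OF n(2)]])
  then show "is_l2 (\<lambda>x. f x + of_real t * g x)"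
    and "l2_norm_sq (\<lambda>x. f x + of_real t * g x)
      = l2_norm_sq f + 2 * t * Re (l2_inner g f) + t\<^sup>2 * l2_norm_sq g"
    unfolding is_l2_def l2_norm_sq_def by (auto simp: has_sum_iff)
qed

lemma l2_norm_sq_scale:
  assumes "is_l2 f"
  shows "is_l2 (\<lambda>x. c * f x)" "l2_norm_sq (\<lambda>x. c * f x) = (norm c)\<^sup>2 * l2_norm_sq f"
  using assms unfolding is_l2_def l2_norm_sq_def
  by (auto simp: norm_mult power_mult_distrib infsum_cmult_right' intro: summable_on_cmult_right)

lemma bij_add_int: "bij (\<lambda>x. x + a :: int)"
  by (rule bij_betw_byWitness[where f' = "\<lambda>x. x - a"]) auto

lemma l2_norm_sq_shift:
  assumes "is_l2 f"
  shows "is_l2 (\<lambda>x. f (x + a))" "l2_norm_sq (\<lambda>x. f (x + a)) = l2_norm_sq f"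
  using assms summable_on_reindex_bij_betw[OF bij_add_int[of a], of "\<lambda>x. (norm (f x))\<^sup>2"]
   infsum_reindex_bij_betw[OF bij_add_int[of a], of "\<lambda>x. (norm (f x))\<^sup>2"]
  unfolding is_l2_def l2_norm_sq_def by auto

lemma l2_inner_self:
  assumes "is_l2 f" shows "l2_inner f f = of_real (l2_norm_sq f)"
proof -
  have "cnj (f x) * f x = of_real ((norm (f x))\<^sup>2)" for x
    by (metis complex_norm_square mult.commute of_real_power)
  moreover have "((\<lambda>x. complex_of_real ((norm (f x))\<^sup>2)) has_sum of_real (l2_norm_sq f)) UNIV"
    using assms unfolding l2_norm_sq_def is_l2_def
    by (intro has_sum_of_real has_sum_infsum)
  ultimately show ?thesis
    unfolding l2_inner_def by (simp add: infsumI)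
qed

subsection \<open>The propagator\<close>

lemma dlap_pow_Suc:
  "(dlap ^^ Suc n) f x = (dlap ^^ n) f (x + 1) + (dlap ^^ n) f (x - 1) - 2 * (dlap ^^ n) f x"
  unfolding funpow.simps o_apply dlap_def[of "(dlap ^^ n) f"] ..

text \<open>The coefficients of \<Delta> have absolute values 1, 1 and 2, so its norm on bounded
  sequences is at most 4.\<close>

lemma norm_dlap_pow_le:
  assumes "\<And>x. norm (f x) \<le> M"
  shows "norm ((dlap ^^ n) f x) \<le> 4 ^ n * M"
proof (induction n arbitrary: x)
  case (Suc n)
  let ?h = "(dlap ^^ n) f"
  have "norm ((dlap ^^ Suc n) f x) \<le> norm (?h (x+1)) + norm (?h (x-1)) + norm (2 * ?h x)"
    unfolding dlap_pow_Suc
    using norm_triangle_ineq4[of "?h (x+1) + ?h (x-1)" "2 * ?h x"] norm_triangle_ineq[of "?h (x+1)" "?h (x-1)"]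
    by linarith
  then show ?case
    using Suc[of "x+1"] Suc[of "x-1"] Suc[of x] by (simp add: norm_mult)
qed (use assms in simp)

lemma dlap_pow_add:
  "(dlap ^^ n) (\<lambda>x. f x + c * g x) = (\<lambda>x. (dlap ^^ n) f x + c * (dlap ^^ n) g x)"
  by (induction n) (auto simp: dlap_pow_Suc fun_eq_iff algebra_simps simp del: funpow.simps(2))

lemma dlap_pow_zero: "(dlap ^^ n) (\<lambda>x. 0) = (\<lambda>x. 0)"
  by (induction n) (auto simp: dlap_pow_Suc fun_eq_iff simp del: funpow.simps(2))

lemma dlap_pow_shift: "(dlap ^^ n) (\<lambda>x. f (x + a)) = (\<lambda>x. (dlap ^^ n) f (x + a))"
proof (induction n)
  case (Suc n)
  have "x + 1 + a = x + a + 1" "x - 1 + a = x + a - 1" for x by auto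
  then show ?case by (simp only: Suc dlap_pow_Suc fun_eq_iff) simp
qed simp

lemma dlap_pow_tendsto:
  assumes "\<And>x. (\<lambda>k. f k x) \<longlonglongrightarrow> g x"
  shows "(\<lambda>k. (dlap ^^ n) (f k) x) \<longlonglongrightarrow> (dlap ^^ n) g x"
proof (induction n arbitrary: x)
  case (Suc n)
  show ?case
    unfolding dlap_pow_Suc by (intro tendsto_intros Suc)
qed (use assms in simp)

text \<open>The majorant is written as a term of the real exponential series, so that
  \<open>sums_exp_bound\<close> sums it; it is the dominating series in all limits taken under the
  sum.\<close>

lemma norm_Sr_term_le:
  assumes "\<And>x. norm (f x) \<le> M"
  shows "norm ((\<i> * complex_of_real r) ^ n / fact n * (dlap ^^ n) f x) \<le> (4 * \<bar>r\<bar>) ^ n /\<^sub>R fact n * M"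
  using mult_left_mono[OF norm_dlap_pow_le[of f M n x, OF assms], of "inverse (fact n) * \<bar>r\<bar> ^ n"]
  by (simp add: norm_mult norm_divide norm_power norm_inverse divide_inverse power_mult_distrib mult_ac)

lemma sums_exp_bound: "(\<lambda>n. (4 * \<bar>r\<bar>) ^ n /\<^sub>R fact n * M) sums (exp (4 * \<bar>r\<bar>) * M)" for r M :: real
  by (intro sums_mult2 exp_converges)

lemma summable_Sr:
  assumes "\<And>x. norm (f x) \<le> M"
  shows "summable (\<lambda>n. (\<i> * complex_of_real r) ^ n / fact n * (dlap ^^ n) f x)"
  by (rule summable_comparison_test'[OF sums_summable[OF sums_exp_bound[of r M]]])
    (rule norm_Sr_term_le[OF assms])

lemma norm_Sr_le_exp:
  assumes "\<And>x. norm (f x) \<le> M"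
  shows "norm (Sr r f x) \<le> exp (4 * \<bar>r\<bar>) * M"
  unfolding Sr_def sums_unique[OF sums_exp_bound[of r M]]
  by (intro norm_suminf_le sums_summable[OF sums_exp_bound] norm_Sr_term_le[OF assms])

lemma Sr_add:
  assumes "\<And>x. norm (f x) \<le> M" "\<And>x. norm (g x) \<le> M'"
  shows "Sr r (\<lambda>x. f x + c * g x) x = Sr r f x + c * Sr r g x"
  unfolding Sr_def dlap_pow_add
  using suminf_add[OF summable_Sr[of f M r x] summable_mult[OF summable_Sr[of g M' r x], of c]]
   suminf_mult[OF summable_Sr[of g M' r x], of c] assms
  by (simp add: algebra_simps)

lemma Sr_zero: "Sr r (\<lambda>x. 0) x = 0"
  unfolding Sr_def dlap_pow_zero by simp

lemma Sr_scale:
  assumes "\<And>x. norm (g x) \<le> M"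
  shows "Sr r (\<lambda>x. c * g x) x = c * Sr r g x"
  using Sr_add[of "\<lambda>x. 0" 0 g M r c x] assms by (simp add: Sr_zero)

lemma Sr_shift: "Sr r (\<lambda>x. f (x + a)) x = Sr r f (x + a)"
  unfolding Sr_def dlap_pow_shift ..

text \<open>\<Delta> annihilates constants, so only the zeroth term survives. Truncations of this
  bounded sequence later show that the quartic form is not identically zero.\<close>

lemma Sr_one: "Sr r (\<lambda>x. 1) x = 1"
proof -
  have "(dlap ^^ Suc n) (\<lambda>x. 1) = (\<lambda>x. 0)" for n
    by (induction n) (simp_all only: dlap_pow_Suc fun_eq_iff funpow_0, simp_all)
  then have "Sr r (\<lambda>x. 1) x = (\<Sum>n. if n = 0 then 1 else 0)"
    unfolding Sr_def by (intro suminf_cong) (auto simp: gr0_conv_Suc simp del: funpow.simps)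
  also have "\<dots> = 1"
    using suminf_finite[of "{0}" "\<lambda>n. if n = 0 then 1 else (0::complex)"] by simp
  finally show ?thesis .
qed

text \<open>Each power of \<Delta> involves finitely many sites and so respects pointwise limits;
  Tannery's theorem carries this through the exponential series, thanks to the common sup
  bound.\<close>

lemma Sr_tendsto:
  assumes "\<And>k x. norm (f k x) \<le> M" "\<And>x. (\<lambda>k. f k x) \<longlonglongrightarrow> g x"
  shows "(\<lambda>k. Sr r (f k) x) \<longlonglongrightarrow> Sr r g x"
proof -
  have "eventually (\<lambda>(n,k). norm ((\<i> * complex_of_real r) ^ n / fact n * (dlap ^^ n) (f k) x)
      \<le> (4 * \<bar>r\<bar>) ^ n /\<^sub>R fact n * M) (at_top \<times>\<^sub>F sequentially)"
    using norm_Sr_term_le[of "f _" M] assms(1) by (intro always_eventually) auto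
  then show ?thesis
    unfolding Sr_def
    by (intro tannerys_theorem[THEN conjunct2, THEN conjunct2, rotated] sums_summable[OF sums_exp_bound]
        tendsto_intros dlap_pow_tendsto assms) (use sums_summable[OF sums_exp_bound] in auto)
qed

lemma Sr_measurable [measurable]: "(\<lambda>r. Sr r f x) \<in> borel_measurable borel"
  unfolding Sr_def by measurable

subsection \<open>Contractivity of the propagator\<close>

text \<open>Cauchy--Schwarz with weights 1, 1, 2 of total 4 bounds the square at each site; summing
  and shifting gives \<open>4 + 4 + 8 = 16\<close>.\<close>

lemma dlap_l2:
  assumes "is_l2 h"
  shows "is_l2 (dlap h)" "l2_norm_sq (dlap h) \<le> 16 * l2_norm_sq h"
proof -
  have sq: "(norm (dlap h x))\<^sup>2 \<le> 4 * (norm (h (x + 1)))\<^sup>2 + 4 * (norm (h (x + -1)))\<^sup>2 + 8 * (norm (h x))\<^sup>2" for x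
  proof -
    have n: "norm (dlap h x) \<le> norm (h (x+1)) + norm (h (x + -1)) + 2 * norm (h x)"
      unfolding dlap_def
      using norm_triangle_ineq4[of "h (x+1) + h (x-1)" "2 * h x"] norm_triangle_ineq[of "h (x+1)" "h (x-1)"]
      by (simp add: norm_mult)
    have sq: "(a + b + 2 * c)\<^sup>2 \<le> 4 * a\<^sup>2 + 4 * b\<^sup>2 + 8 * c\<^sup>2" for a b c :: real
    proof -
      have "0 \<le> (a - b)\<^sup>2 + 2 * (a - c)\<^sup>2 + 2 * (b - c)\<^sup>2" by simp
      then show ?thesis by (simp add: power2_eq_square algebra_simps)
    qed
    show ?thesis
      by (rule order_trans[OF power_mono[OF n norm_ge_zero] sq])
  qed
  have F: "(\<Sum>x\<in>F. (norm (dlap h x))\<^sup>2) \<le> 16 * l2_norm_sq h" if "finite F" for F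
  proof -
    have "(\<Sum>x\<in>F. (norm (dlap h x))\<^sup>2)
      \<le> 4 * (\<Sum>x\<in>F. (norm (h (x + 1)))\<^sup>2) + 4 * (\<Sum>x\<in>F. (norm (h (x + -1)))\<^sup>2) + 8 * (\<Sum>x\<in>F. (norm (h x))\<^sup>2)"
      unfolding sum_distrib_left sum.distrib[symmetric] by (intro sum_mono sq)
    then show ?thesis
      using sum_le_l2_norm_sq[OF l2_norm_sq_shift(1)[OF assms, of 1] that]
       sum_le_l2_norm_sq[OF l2_norm_sq_shift(1)[OF assms, of "-1"] that]
       sum_le_l2_norm_sq[OF assms that]
      unfolding l2_norm_sq_shift(2)[OF assms] by linarith
  qed
  show "is_l2 (dlap h)" "l2_norm_sq (dlap h) \<le> 16 * l2_norm_sq h"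
    using is_l2_I[OF F] by auto
qed

text \<open>One explicit Euler step \<open>1 + c \<Delta>\<close>. With
  \<open>c = \<i> r / N\<close>, its \<open>N\<close>-th iterate approximates the exponential and
  gives access to the \<open>l^2\<close> norm.\<close>

definition euler_step :: "complex \<Rightarrow> (int \<Rightarrow> complex) \<Rightarrow> int \<Rightarrow> complex" where
  "euler_step c h x = h x + c * dlap h x"

text \<open>The term linear in \<open>s\<close> sums to zero, which is the symmetry of \<Delta>;
  only the quadratic term remains, and \<open>dlap_l2\<close> bounds it.\<close>

lemma euler_step_l2:
  assumes "is_l2 h"
  shows "is_l2 (euler_step (\<i> * of_real s) h)"
    and "l2_norm_sq (euler_step (\<i> * of_real s) h) \<le> (1 + 16 * s\<^sup>2) * l2_norm_sq h"
proof -
  \<comment> \<open>\<open>A x\<close> is the current through the bond from \<open>x\<close> to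
    \<open>x + 1\<close>. The linear term at \<open>x\<close> is a difference of neighbouring
    currents, and translation invariance of the sum cancels it.\<close>
  define A where "A x = Im (cnj (h x) * h (x + 1))" for x
  have "((\<lambda>x. cnj (h x) * h (x + 1)) has_sum l2_inner h (\<lambda>x. h (x + 1))) UNIV"
    unfolding l2_inner_def
    by (rule has_sum_infsum[OF abs_summable_summable[OF abs_summable_l2_inner]])
      (intro assms l2_norm_sq_shift)+
  then have A: "(A has_sum infsum A UNIV) UNIV"
    using has_sum_Im unfolding A_def[abs_def] by (metis has_sum_iff)
  then have A': "((\<lambda>x. A (x + -1)) has_sum infsum A UNIV) UNIV"
    using has_sum_reindex_bij_betw[OF bij_add_int[of "-1"], of A] by simp
  have e: "(norm (euler_step (\<i> * of_real s) h x))\<^sup>2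
      = (norm (h x))\<^sup>2 + s\<^sup>2 * (norm (dlap h x))\<^sup>2 + 2 * s * (A (x + -1) + (- A x))" for x
    unfolding A_def euler_step_def dlap_def cmod_power2 by (simp add: power2_eq_square algebra_simps)
  have "((\<lambda>x. (norm (euler_step (\<i> * of_real s) h x))\<^sup>2) has_sum
      (l2_norm_sq h + s\<^sup>2 * l2_norm_sq (dlap h) + 2 * s * (infsum A UNIV + - infsum A UNIV))) UNIV"
    unfolding e l2_norm_sq_def
    by (rule has_sum_add[OF has_sum_add[OF has_sum_infsum has_sum_cmult_right[OF has_sum_infsum]]
         has_sum_cmult_right[OF has_sum_add[OF A']]])
      (use assms dlap_l2(1)[OF assms] A in \<open>auto simp: is_l2_def has_sum_uminus\<close>)
  then have "is_l2 (euler_step (\<i> * of_real s) h)"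
    "l2_norm_sq (euler_step (\<i> * of_real s) h) = l2_norm_sq h + s\<^sup>2 * l2_norm_sq (dlap h)"
    unfolding is_l2_def l2_norm_sq_def by (auto simp: has_sum_iff)
  then show "is_l2 (euler_step (\<i> * of_real s) h)"
     "l2_norm_sq (euler_step (\<i> * of_real s) h) \<le> (1 + 16 * s\<^sup>2) * l2_norm_sq h"
    using mult_left_mono[OF dlap_l2(2)[OF assms], of "s\<^sup>2"] by (auto simp: algebra_simps)
qed

lemma euler_steps_l2:
  assumes "is_l2 h"
  shows "is_l2 ((euler_step (\<i> * of_real s) ^^ n) h)"
    and "l2_norm_sq ((euler_step (\<i> * of_real s) ^^ n) h) \<le> (1 + 16 * s\<^sup>2) ^ n * l2_norm_sq h"
proof (induction n)
  case (Suc n)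
  { case 1 show ?case using euler_step_l2(1)[OF Suc(1)] by simp }
  { case 2
    have "l2_norm_sq ((euler_step (\<i> * of_real s) ^^ Suc n) h)
        \<le> (1 + 16 * s\<^sup>2) * l2_norm_sq ((euler_step (\<i> * of_real s) ^^ n) h)"
      using euler_step_l2(2)[OF Suc(1)] by simp
    also have "\<dots> \<le> (1 + 16 * s\<^sup>2) * ((1 + 16 * s\<^sup>2) ^ n * l2_norm_sq h)"
      using Suc(2) by (intro mult_left_mono) auto
    finally show ?case by (simp add: mult.assoc) }
qed (use assms in auto)

text \<open>The binomial theorem for the operator \<open>1 + c \<Delta>\<close>, obtained from
  Pascal's rule.\<close>

lemma euler_steps_binomial:
  "(euler_step c ^^ N) f x = (\<Sum>n\<le>N. of_nat (N choose n) * c ^ n * (dlap ^^ n) f x)"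
proof (induction N arbitrary: x)
  case (Suc N)
  define a where "a M n = of_nat (M choose n) * c ^ n" for M n
  define u where "u n = (dlap ^^ n) f x" for n
  have IH: "(euler_step c ^^ N) f = (\<lambda>x. \<Sum>n\<le>N. a N n * (dlap ^^ n) f x)"
    using Suc by (simp add: a_def fun_eq_iff)
  have "dlap ((euler_step c ^^ N) f) x = (\<Sum>n\<le>N. a N n * u (Suc n))"
    unfolding IH dlap_def[of "\<lambda>x. \<Sum>n\<le>N. _ n x"] u_def dlap_pow_Suc
    by (simp add: sum.distrib sum_subtractf algebra_simps sum_distrib_left)
  then have "(euler_step c ^^ Suc N) f x = (\<Sum>n\<le>N. a N n * u n) + c * (\<Sum>n\<le>N. a N n * u (Suc n))"
    unfolding funpow.simps o_apply euler_step_def[of c "(euler_step c ^^ N) f"]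
    by (simp add: IH u_def)
  \<comment> \<open>The added term has the coefficient \<open>N choose Suc N = 0\<close>; after an
    index shift both sums run over the same range.\<close>
  also have "(\<Sum>n\<le>N. a N n * u n) = (\<Sum>n\<le>Suc N. a N n * u n)"
    by (simp add: a_def)
  also have "\<dots> = u 0 + (\<Sum>n\<le>N. a N (Suc n) * u (Suc n))"
    by (subst sum.atMost_Suc_shift) (simp add: a_def)
  also have "u 0 + (\<Sum>n\<le>N. a N (Suc n) * u (Suc n)) + c * (\<Sum>n\<le>N. a N n * u (Suc n))
     = u 0 + (\<Sum>n\<le>N. a (Suc N) (Suc n) * u (Suc n))"
    by (simp add: a_def sum_distrib_left sum.distrib[symmetric] algebra_simps)
  also have "\<dots> = (\<Sum>n\<le>Suc N. a (Suc N) n * u n)"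
    by (subst sum.atMost_Suc_shift) (simp add: a_def)
  finally show ?case by (simp add: a_def u_def)
qed simp

text \<open>For \<open>n > 0\<close> the quotient is the product of the \<open>k\<close> factors
  \<open>1 - i / n\<close> divided by \<open>fact k\<close>, and each factor tends to 1.\<close>

lemma binomial_over_power_tendsto:
  "(\<lambda>n. real (n choose k) / real n ^ k) \<longlonglongrightarrow> 1 / fact k"
proof -
  have "(\<lambda>n. (\<Prod>i<k. 1 - real i / real n) / fact k) \<longlonglongrightarrow> (\<Prod>i<k. 1 - 0) / fact k"
    by (intro tendsto_intros lim_const_over_n) simp
  moreover have "eventually (\<lambda>n. (\<Prod>i<k. 1 - real i / real n) / fact k = real (n choose k) / real n ^ k) sequentially"
    using eventually_gt_at_top[of 0]
  proof eventually_elim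
    case (elim n)
    have "(\<Prod>i<k. 1 - real i / real n) = (\<Prod>i<k. (real n - real i) / real n)"
      using elim by (intro prod.cong) (auto simp: field_simps)
    then show ?case
      by (simp add: binomial_gbinomial gbinomial_prod_rev prod_dividef lessThan_atLeast0)
  qed
  ultimately show ?thesis by (auto intro: Lim_transform_eventually)
qed

text \<open>The coefficients of the binomial expansion tend to those of the exponential series and
  are dominated by them in absolute value, since \<open>(N choose n) * fact n \<le> N ^ n\<close>.
  Tannery's theorem then applies. Indexing by \<open>Suc N\<close> avoids division by zero.\<close>

lemma euler_steps_tendsto_Sr:
  assumes "\<And>x. norm (f x) \<le> M"
  shows "(\<lambda>N. (euler_step (\<i> * of_real (r / of_nat (Suc N))) ^^ Suc N) f x) \<longlonglongrightarrow> Sr r f x"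
proof -
  define a where "a n N = of_nat (Suc N choose n) * (\<i> * of_real (r / of_nat (Suc N))) ^ n * (dlap ^^ n) f x" for n N
  have eq: "a n N = of_real (real (Suc N choose n) / real (Suc N) ^ n) * ((\<i> * of_real r) ^ n * (dlap ^^ n) f x)" for n N
    unfolding a_def by (simp add: power_mult_distrib power_divide del: of_nat_Suc)
  have lim: "(\<lambda>N. a n N) \<longlonglongrightarrow> (\<i> * of_real r) ^ n / fact n * (dlap ^^ n) f x" for n
  proof -
    have "(\<lambda>N. a n N) \<longlonglongrightarrow> of_real (1 / fact n) * ((\<i> * of_real r) ^ n * (dlap ^^ n) f x)"
      unfolding eq by (intro tendsto_intros LIMSEQ_Suc[OF binomial_over_power_tendsto])
    then show ?thesis by simp
  qed
  have bnd: "norm (a n N) \<le> (4 * \<bar>r\<bar>) ^ n /\<^sub>R fact n * M" for n N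
  proof -
    have "real ((Suc N choose n) * fact n) \<le> real (Suc N ^ n)"
      using binomial_fact_pow by (simp only: of_nat_le_iff)
    then have "real (Suc N choose n) / real (Suc N) ^ n \<le> inverse (fact n)"
      by (simp add: field_simps del: of_nat_Suc)
    then have "real (Suc N choose n) / real (Suc N) ^ n * (\<bar>r\<bar> ^ n * norm ((dlap ^^ n) f x))
       \<le> inverse (fact n) * (\<bar>r\<bar> ^ n * (4 ^ n * M))"
      by (intro mult_mono norm_dlap_pow_le assms) auto
    then show ?thesis
      unfolding eq norm_mult norm_of_real norm_power
      by (simp add: power_mult_distrib mult_ac del: of_nat_Suc)
  qed
  have "(\<lambda>N. \<Sum>n. a n N) \<longlonglongrightarrow> Sr r f x"
    unfolding Sr_def
    by (intro tannerys_theorem[THEN conjunct2, THEN conjunct2] sums_summable[OF sums_exp_bound] lim)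
      (use sums_summable[OF sums_exp_bound] in \<open>auto intro!: always_eventually bnd\<close>)
  \<comment> \<open>Binomial coefficients with \<open>n > Suc N\<close> vanish, so the series is a
    finite sum.\<close>
  moreover have "(\<Sum>n. a n N) = (euler_step (\<i> * of_real (r / of_nat (Suc N))) ^^ Suc N) f x" for N
    unfolding euler_steps_binomial a_def[symmetric]
    by (rule suminf_finite) (auto simp: a_def)
  ultimately show ?thesis by (simp only:)
qed

text \<open>Since \<open>1 + x \<le> exp x\<close>, all \<open>Suc N\<close> Euler steps together
  enlarge the squared norm by at most \<open>exp (16 * r^2 / Suc N)\<close>, which tends to 1. The
  bound passes to the pointwise limit.\<close>

lemma Sr_l2:
  assumes "is_l2 f"
  shows "is_l2 (Sr r f)" "l2_norm_sq (Sr r f) \<le> l2_norm_sq f"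
proof -
  let ?E = "\<lambda>N. (euler_step (\<i> * of_real (r / of_nat (Suc N))) ^^ Suc N) f"
  let ?B = "\<lambda>N. exp (16 * r\<^sup>2 / real (Suc N)) * l2_norm_sq f"
  have le: "l2_norm_sq (?E N) \<le> ?B N" for N
  proof -
    have "(1 + 16 * (r / real (Suc N))\<^sup>2) ^ Suc N \<le> exp (16 * (r / real (Suc N))\<^sup>2) ^ Suc N"
      by (intro power_mono exp_ge_add_one_self) auto
    also have "\<dots> = exp (16 * r\<^sup>2 / real (Suc N))"
      unfolding exp_of_nat_mult[symmetric] by (simp add: power2_eq_square del: of_nat_Suc)
    finally show ?thesis
      using euler_steps_l2(2)[OF assms, where s = "r / real (Suc N)" and n = "Suc N"] l2_norm_sq_nonneg[of f]
      by (meson mult_right_mono order_trans)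
  qed
  have "?B \<longlonglongrightarrow> exp 0 * l2_norm_sq f"
    by (intro tendsto_intros LIMSEQ_Suc[OF lim_const_over_n])
  then have B: "?B \<longlonglongrightarrow> l2_norm_sq f" by simp
  show "is_l2 (Sr r f)" "l2_norm_sq (Sr r f) \<le> l2_norm_sq f"
    using is_l2_pointwise_limit[of ?E ?B, OF euler_steps_l2(1)[OF assms] le B
       euler_steps_tendsto_Sr[OF norm_le_sqrt_l2_norm_sq[OF assms]]] by auto
qed

subsection \<open>The quartic form\<close>

locale finite_real_measure = finite_measure \<mu> for \<mu> :: "real measure" +
  assumes sets_eq_borel: "sets \<mu> = sets borel"
begin

abbreviation mass :: real where "mass \<equiv> measure \<mu> (space \<mu>)"

definition Sr_mass :: "(int \<Rightarrow> complex) \<Rightarrow> int \<Rightarrow> real" where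
  "Sr_mass h x = (LINT r|\<mu>. (norm (Sr r h x))\<^sup>2)"

definition Sr_quartic :: "(int \<Rightarrow> complex) \<Rightarrow> int \<Rightarrow> real" where
  "Sr_quartic h x = (LINT r|\<mu>. norm (Sr r h x) ^ 4)"

text \<open>The diagonal form as a real number. On \<open>l^2\<close> it agrees with both the
  extended-real \<open>Qd_diag\<close> and the complex \<open>Qd\<close>, by
  \<open>Qd_diag_eq_Qr\<close> and \<open>Qd_self_eq_Qr\<close>.\<close>

definition Qr :: "(int \<Rightarrow> complex) \<Rightarrow> real" where
  "Qr h = (\<Sum>\<^sub>\<infinity>x. Sr_quartic h x)"

definition Sr_cubic :: "(int \<Rightarrow> complex) \<Rightarrow> (int \<Rightarrow> complex) \<Rightarrow> int \<Rightarrow> complex" where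
  "Sr_cubic g h x = (LINT r|\<mu>. cnj (Sr r g x) * Sr r h x * cnj (Sr r h x) * Sr r h x)"

lemma Qd_eq_infsum_cubic: "Qd \<mu> g h h h = (\<Sum>\<^sub>\<infinity>x. Sr_cubic g h x)"
  by (simp add: Qd_def Sr_cubic_def)

lemma Sr_measurable_mu [measurable]: "(\<lambda>r. Sr r f x) \<in> borel_measurable \<mu>"
  using Sr_measurable by (subst measurable_cong_sets[OF sets_eq_borel refl])

lemma cubic_measurable [measurable]:
  "(\<lambda>r. cnj (Sr r g x) * Sr r f x * cnj (Sr r f x) * Sr r f x) \<in> borel_measurable \<mu>"
proof -
  have [measurable]: "cnj \<in> borel_measurable borel"
    by (intro borel_measurable_continuous_onI continuous_intros)
  show ?thesis by measurable
qed

lemma norm_Sr_sq_le: "is_l2 f \<Longrightarrow> (norm (Sr r f x))\<^sup>2 \<le> l2_norm_sq f"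
  using norm_sq_le_l2_norm_sq[OF Sr_l2(1), of f r x] Sr_l2(2)[of f r] by simp

lemma norm_Sr_le: "is_l2 f \<Longrightarrow> norm (Sr r f x) \<le> sqrt (l2_norm_sq f)"
  using norm_Sr_sq_le[of f r x] by (simp add: real_le_rsqrt)

lemma integrable_Sr_sq: "is_l2 f \<Longrightarrow> integrable \<mu> (\<lambda>r. (norm (Sr r f x))\<^sup>2)"
  by (rule integrable_const_bound[of _ "l2_norm_sq f"]) (auto intro!: norm_Sr_sq_le)

lemma integrable_Sr_quartic: "is_l2 f \<Longrightarrow> integrable \<mu> (\<lambda>r. norm (Sr r f x) ^ 4)"
  by (rule integrable_const_bound[of _ "sqrt (l2_norm_sq f) ^ 4"])
    (auto intro!: power_mono norm_Sr_le)

lemma norm_cubic_le: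
  assumes "is_l2 f"
  shows "norm (cnj (Sr r g x) * Sr r f x * cnj (Sr r f x) * Sr r f x)
    \<le> l2_norm_sq f * (norm (Sr r g x) * norm (Sr r f x))"
proof -
  have "norm (cnj (Sr r g x) * Sr r f x * cnj (Sr r f x) * Sr r f x)
    = (norm (Sr r f x))\<^sup>2 * (norm (Sr r g x) * norm (Sr r f x))"
    by (simp add: norm_mult power2_eq_square mult_ac)
  also have "\<dots> \<le> l2_norm_sq f * (norm (Sr r g x) * norm (Sr r f x))"
    by (intro mult_right_mono norm_Sr_sq_le assms) simp
  finally show ?thesis .
qed

lemma norm_cubic_le_const:
  assumes "is_l2 f" "is_l2 g"
  shows "norm (cnj (Sr r g x) * Sr r f x * cnj (Sr r f x) * Sr r f x)
    \<le> l2_norm_sq f * (sqrt (l2_norm_sq g) * sqrt (l2_norm_sq f))"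
  by (rule order_trans[OF norm_cubic_le[OF assms(1)]])
    (intro mult_left_mono mult_mono norm_Sr_le assms l2_norm_sq_nonneg real_sqrt_ge_zero norm_ge_zero)

lemma integrable_cubic:
  assumes "is_l2 f" "is_l2 g"
  shows "integrable \<mu> (\<lambda>r. cnj (Sr r g x) * Sr r f x * cnj (Sr r f x) * Sr r f x)"
  by (rule integrable_const_bound[of _ "l2_norm_sq f * (sqrt (l2_norm_sq g) * sqrt (l2_norm_sq f))"])
    (use norm_cubic_le_const[OF assms] in auto)

lemma Sr_mass_nonneg: "0 \<le> Sr_mass h x"
  by (simp add: Sr_mass_def)

lemma Sr_quartic_nonneg: "0 \<le> Sr_quartic h x"
  by (simp add: Sr_quartic_def)

text \<open>Over a finite set the sum moves inside the integral, where contractivity bounds it by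
  \<open>l2_norm_sq h\<close> for every \<open>r\<close>.\<close>

lemma Sr_mass_summable:
  assumes "is_l2 h"
  shows "Sr_mass h summable_on UNIV" "infsum (Sr_mass h) UNIV \<le> l2_norm_sq h * mass"
proof -
  have F: "sum (Sr_mass h) F \<le> l2_norm_sq h * mass" if "finite F" for F
  proof -
    have "sum (Sr_mass h) F = (LINT r|\<mu>. (\<Sum>x\<in>F. (norm (Sr r h x))\<^sup>2))"
      unfolding Sr_mass_def by (intro Bochner_Integration.integral_sum[symmetric] integrable_Sr_sq assms)
    also have "\<dots> \<le> (LINT r|\<mu>. l2_norm_sq h)"
      using sum_le_l2_norm_sq[OF Sr_l2(1)[OF assms] that] Sr_l2(2)[OF assms]
      by (intro integral_mono Bochner_Integration.integrable_sum integrable_Sr_sq assms)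
        (auto intro: order_trans)
    finally show ?thesis by (simp add: mult.commute)
  qed
  show "Sr_mass h summable_on UNIV"
    by (rule nonneg_bdd_above_summable_on) (use F Sr_mass_nonneg in \<open>auto intro!: bdd_aboveI2\<close>)
  then show "infsum (Sr_mass h) UNIV \<le> l2_norm_sq h * mass"
    by (rule infsum_le_finite_sums) (use F in auto)
qed

text \<open>The bound \<open>B\<close> is left free for two uses: the squared \<open>l^2\<close>
  norm yields finiteness, and a sup bound valid on the support of \<mu> excludes vanishing.\<close>

lemma Sr_quartic_le_AE:
  assumes "is_l2 h" "AE r in \<mu>. (norm (Sr r h x))\<^sup>2 \<le> B"
  shows "Sr_quartic h x \<le> B * Sr_mass h x"
proof -
  have "(LINT r|\<mu>. norm (Sr r h x) ^ 4) \<le> (LINT r|\<mu>. B * (norm (Sr r h x))\<^sup>2)"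
  proof (rule integral_mono_AE)
    show "AE r in \<mu>. norm (Sr r h x) ^ 4 \<le> B * (norm (Sr r h x))\<^sup>2"
      using assms(2)
    proof eventually_elim
      case (elim r)
      have "norm (Sr r h x) ^ 4 = (norm (Sr r h x))\<^sup>2 * (norm (Sr r h x))\<^sup>2" by (simp flip: power_add)
      then show ?case using mult_right_mono[OF elim, of "(norm (Sr r h x))\<^sup>2"] by simp
    qed
  qed (intro integrable_Sr_quartic integrable_Sr_sq assms integrable_mult_right)+
  then show ?thesis by (simp add: Sr_quartic_def Sr_mass_def)
qed

lemma Sr_quartic_le: "is_l2 h \<Longrightarrow> Sr_quartic h x \<le> l2_norm_sq h * Sr_mass h x"
  by (rule Sr_quartic_le_AE) (auto simp: norm_Sr_sq_le)

lemma Sr_quartic_summable: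
  assumes "is_l2 h" shows "Sr_quartic h summable_on UNIV"
  by (rule summable_on_comparison_test[OF summable_on_cmult_right[OF Sr_mass_summable(1)[OF assms]]])
    (use Sr_quartic_le[OF assms] Sr_quartic_nonneg in auto)

lemma Qr_le_AE:
  assumes "is_l2 h" "\<And>x. AE r in \<mu>. (norm (Sr r h x))\<^sup>2 \<le> B" "0 \<le> B"
  shows "Qr h \<le> B * (l2_norm_sq h * mass)"
proof -
  have "Qr h \<le> (\<Sum>\<^sub>\<infinity>x. B * Sr_mass h x)"
    unfolding Qr_def
    by (intro infsum_mono Sr_quartic_summable summable_on_cmult_right Sr_mass_summable Sr_quartic_le_AE assms)
  also have "\<dots> \<le> B * (l2_norm_sq h * mass)"
    unfolding infsum_cmult_right' by (intro mult_left_mono Sr_mass_summable assms)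
  finally show ?thesis .
qed

lemma Qr_le: "is_l2 h \<Longrightarrow> Qr h \<le> l2_norm_sq h * (l2_norm_sq h * mass)"
  by (rule Qr_le_AE) (auto simp: norm_Sr_sq_le l2_norm_sq_nonneg)

lemma Qr_nonneg: "0 \<le> Qr h"
  unfolding Qr_def by (intro infsum_nonneg Sr_quartic_nonneg)

lemma Qd_diag_eq_Qr:
  assumes "is_l2 h" shows "Qd_diag \<mu> h = ennreal (Qr h)"
proof -
  have "Qd_diag \<mu> h = (\<integral>\<^sup>+ x. ennreal (Sr_quartic h x) \<partial>count_space UNIV)"
    unfolding Qd_diag_def Sr_quartic_def
    by (intro nn_integral_cong nn_integral_eq_integral integrable_Sr_quartic assms) auto
  also have "\<dots> = ennreal (infsetsum (Sr_quartic h) UNIV)"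
    using Sr_quartic_summable[OF assms] Sr_quartic_nonneg
    by (intro nn_integral_conv_infsetsum) (auto simp flip: abs_summable_equivalent)
  also have "infsetsum (Sr_quartic h) UNIV = Qr h"
    unfolding Qr_def
    using Sr_quartic_summable[OF assms] Sr_quartic_nonneg
    by (intro infsetsum_infsum) (auto simp flip: abs_summable_equivalent)
  finally show ?thesis .
qed

lemma Qd_self_eq_Qr:
  assumes "is_l2 h" shows "Qd \<mu> h h h h = of_real (Qr h)"
proof -
  have "cnj z * z * cnj z * z = of_real (norm z ^ 4)" for z :: complex
  proof -
    have "cnj z * z * cnj z * z = (z * cnj z) * (z * cnj z)" by (simp add: mult_ac)
    also have "\<dots> = of_real (norm z ^ 4)"
      by (simp add: complex_norm_square[symmetric] flip: power_add)
    finally show ?thesis .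
  qed
  then have "Sr_cubic h h = (\<lambda>x. of_real (Sr_quartic h x))"
    unfolding Sr_cubic_def Sr_quartic_def by (simp only: integral_complex_of_real)
  moreover have "((\<lambda>x. complex_of_real (Sr_quartic h x)) has_sum of_real (Qr h)) UNIV"
    unfolding Qr_def by (intro has_sum_of_real has_sum_infsum Sr_quartic_summable assms)
  ultimately show ?thesis
    unfolding Qd_eq_infsum_cubic by (simp add: infsumI)
qed

text \<open>Two factors \<open>Sr r f x\<close> are absorbed into \<open>l2_norm_sq f\<close>, and
  Young's inequality separates the other one from \<open>Sr r g x\<close>. The weight falls on
  \<open>f\<close>, which will vary along a sequence while \<open>g\<close> stays fixed.\<close>

lemma norm_Sr_cubic_le:
  assumes "is_l2 f" "is_l2 g" "e > 0"
  shows "norm (Sr_cubic g f x) \<le> e * (l2_norm_sq f * Sr_mass f x) + l2_norm_sq f * Sr_mass g x / e"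
proof -
  have "norm (Sr_cubic g f x)
     \<le> (LINT r|\<mu>. l2_norm_sq f * (e * (norm (Sr r f x))\<^sup>2 + (norm (Sr r g x))\<^sup>2 / e))"
    unfolding Sr_cubic_def
  proof (rule Bochner_Integration.integral_norm_bound_integral)
    fix r
    have "norm (Sr r g x) * norm (Sr r f x) \<le> e * (norm (Sr r f x))\<^sup>2 + (norm (Sr r g x))\<^sup>2 / e"
      using mult_le_weighted_squares[OF assms(3), of "norm (Sr r f x)" "norm (Sr r g x)"] by (simp add: mult.commute)
    then show "norm (cnj (Sr r g x) * Sr r f x * cnj (Sr r f x) * Sr r f x)
        \<le> l2_norm_sq f * (e * (norm (Sr r f x))\<^sup>2 + (norm (Sr r g x))\<^sup>2 / e)"
      by (rule order_trans[OF norm_cubic_le[OF assms(1)] mult_left_mono[OF _ l2_norm_sq_nonneg]])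
  qed (intro integrable_cubic assms integrable_mult_right Bochner_Integration.integrable_add
        integrable_divide_zero integrable_Sr_sq)+
  also have "\<dots> = e * (l2_norm_sq f * Sr_mass f x) + l2_norm_sq f * Sr_mass g x / e"
    unfolding Sr_mass_def
    by (subst integral_mult_right_zero, subst Bochner_Integration.integral_add)
      (auto intro!: integrable_Sr_sq assms simp: algebra_simps)
  finally show ?thesis .
qed

lemma Sr_cubic_summable:
  assumes "is_l2 f" "is_l2 g"
  shows "Sr_cubic g f summable_on UNIV"
proof (rule abs_summable_summable, rule Infinite_Sum.abs_summable_on_comparison_test')
  show "(\<lambda>x. 1 * (l2_norm_sq f * Sr_mass f x) + l2_norm_sq f * Sr_mass g x / 1) summable_on UNIV"
    unfolding div_by_1 by (intro summable_on_add summable_on_cmult_right Sr_mass_summable assms)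
qed (rule norm_Sr_cubic_le[OF assms], simp)

text \<open>Pointwise convergence at constant norm suffices because the fixed \<open>g\<close>
  localizes the sum. At each site, dominated convergence applies with a constant majorant,
  integrable because \<mu> is finite.\<close>

lemma Qd_tendsto:
  assumes f: "\<And>n. is_l2 (f n)" "\<And>n. l2_norm_sq (f n) = L" and g: "is_l2 g"
    and lim: "\<And>x. (\<lambda>n. f n x) \<longlonglongrightarrow> f' x"
  shows "(\<lambda>n. Qd \<mu> g (f n) (f n) (f n)) \<longlonglongrightarrow> Qd \<mu> g f' f' f'"
  unfolding Qd_eq_infsum_cubic
proof (rule infsum_tendsto_of_weighted_bound)
  have L: "0 \<le> L" using l2_norm_sq_nonneg[of "f 0"] f(2) by simp
  have S: "(\<lambda>n. Sr r (f n) x) \<longlonglongrightarrow> Sr r f' x" for r x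
    using norm_le_sqrt_l2_norm_sq[OF f(1)] f(2) by (intro Sr_tendsto[of _ "sqrt L"] lim) simp
  show "(\<lambda>n. Sr_cubic g (f n) x) \<longlonglongrightarrow> Sr_cubic g f' x" for x
    unfolding Sr_cubic_def
  proof (rule integral_dominated_convergence[where w = "\<lambda>_. L * (sqrt (l2_norm_sq g) * sqrt L)"])
    show "AE r in \<mu>. norm (cnj (Sr r g x) * Sr r (f n) x * cnj (Sr r (f n) x) * Sr r (f n) x)
        \<le> L * (sqrt (l2_norm_sq g) * sqrt L)" for n
      using norm_cubic_le_const[OF f(1)[of n] g] f(2)[of n] by simp
  qed (auto intro!: tendsto_intros S AE_I2)
  show "norm (Sr_cubic g (f n) x) \<le> e * (L * Sr_mass (f n) x) + L * Sr_mass g x / e" if "e > 0" for e n x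
    using norm_Sr_cubic_le[OF f(1) g that, of n x] by (simp add: f(2))
  show "(\<lambda>x. L * Sr_mass (f n) x) summable_on UNIV" for n
    by (intro summable_on_cmult_right Sr_mass_summable f)
  show "(\<lambda>x. L * Sr_mass g x) summable_on UNIV"
    by (intro summable_on_cmult_right Sr_mass_summable g)
  show "(\<Sum>\<^sub>\<infinity>x. L * Sr_mass (f n) x) \<le> L * (L * mass)" for n
    unfolding infsum_cmult_right' using Sr_mass_summable(2)[OF f(1), of n]
    by (intro mult_left_mono L) (simp add: f(2))
qed (auto intro!: mult_nonneg_nonneg Sr_mass_nonneg simp: f(2)[of 0, symmetric] l2_norm_sq_nonneg)

section \<open>Homogeneity, translation invariance and convexity of the form\<close>

lemma Qd_scale:
  assumes "is_l2 g"
  shows "Qd \<mu> (\<lambda>x. c * g x) f f f = cnj c * Qd \<mu> g f f f"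
proof -
  have "Sr_cubic (\<lambda>x. c * g x) f x = cnj c * Sr_cubic g f x" for x
    unfolding Sr_cubic_def Sr_scale[of g, OF norm_le_sqrt_l2_norm_sq[OF assms]]
    by (subst integral_mult_right_zero[symmetric]) (simp add: mult_ac)
  then show ?thesis
    by (simp add: Qd_eq_infsum_cubic infsum_cmult_right')
qed

lemma Qr_scale:
  assumes "is_l2 f"
  shows "Qr (\<lambda>x. c * f x) = norm c ^ 4 * Qr f"
  unfolding Qr_def Sr_quartic_def Sr_scale[of f, OF norm_le_sqrt_l2_norm_sq[OF assms]]
  by (simp add: norm_mult power_mult_distrib infsum_cmult_right')

lemma Qr_shift: "Qr (\<lambda>x. f (x + a)) = Qr f"
  using infsum_reindex_bij_betw[OF bij_add_int[of a], of "Sr_quartic f"]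
  unfolding Qr_def Sr_quartic_def Sr_shift by simp

text \<open>With \<open>u\<close> and \<open>v\<close> the squared moduli, this combines the tangent
  inequality \<open>u^2 + 2 * u * (v - u) \<le> v^2\<close> with
  \<open>v - u \<ge> 2 * t * Re (cnj b * a)\<close>.\<close>

lemma norm_quartic_convex:
  "norm a ^ 4 + 4 * t * Re (cnj b * a * cnj a * a) \<le> norm (a + of_real t * b) ^ 4"
  for a b :: complex
proof -
  define u v where "u = (norm a)\<^sup>2" and "v = (norm (a + of_real t * b))\<^sup>2"
  have v: "v = u + 2 * t * Re (cnj b * a) + t\<^sup>2 * (norm b)\<^sup>2"
    unfolding u_def v_def cmod_power2 by (simp add: power2_eq_square algebra_simps)
  have "cnj b * a * cnj a * a = of_real u * (cnj b * a)"
    using complex_norm_square[of a] by (simp add: u_def mult_ac)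
  then have r: "Re (cnj b * a * cnj a * a) = u * Re (cnj b * a)"
    by (metis scaleR_complex.sel(1) scaleR_conv_of_real)
  have "0 \<le> u" by (simp add: u_def)
  have "u\<^sup>2 + 4 * t * (u * Re (cnj b * a)) \<le> u\<^sup>2 + 2 * u * (v - u)"
    unfolding v using \<open>0 \<le> u\<close> by (simp add: algebra_simps)
  also have "\<dots> \<le> v\<^sup>2"
    using zero_le_power2[of "v - u"] by (simp add: power2_eq_square algebra_simps)
  finally show ?thesis
    unfolding r by (simp add: u_def v_def flip: power_mult)
qed

text \<open>The pointwise tangent inequality, integrated and summed;
  \<open>4 * Re (Qd \<mu> g f f f)\<close> is the slope of the tangent at \<open>f\<close> in
  direction \<open>g\<close>.\<close>

lemma Qr_convex:
  assumes "is_l2 f" "is_l2 g"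
  shows "Qr f + 4 * t * Re (Qd \<mu> g f f f) \<le> Qr (\<lambda>x. f x + of_real t * g x)"
proof -
  note ft = l2_norm_sq_add(1)[OF assms, of t]
  have S: "Sr r (\<lambda>x. f x + of_real t * g x) x = Sr r f x + of_real t * Sr r g x" for r x
    by (rule Sr_add) (rule norm_le_sqrt_l2_norm_sq, fact)+
  have "Sr_quartic f x + 4 * t * Re (Sr_cubic g f x) \<le> Sr_quartic (\<lambda>x. f x + of_real t * g x) x" for x
  proof -
    have i: "integrable \<mu> (\<lambda>r. Re (cnj (Sr r g x) * Sr r f x * cnj (Sr r f x) * Sr r f x))"
      by (intro integrable_Re integrable_cubic assms)
    have "Sr_quartic f x + 4 * t * Re (Sr_cubic g f x)
      = (LINT r|\<mu>. norm (Sr r f x) ^ 4 + 4 * t * Re (cnj (Sr r g x) * Sr r f x * cnj (Sr r f x) * Sr r f x))"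
      unfolding Sr_quartic_def Sr_cubic_def integral_Re[OF integrable_cubic[OF assms], symmetric]
      by (subst Bochner_Integration.integral_add)
        (use i in \<open>auto intro: integrable_Sr_quartic assms simp del: times_complex.sel\<close>)
    also have "\<dots> \<le> Sr_quartic (\<lambda>x. f x + of_real t * g x) x"
      unfolding Sr_quartic_def
      by (intro integral_mono Bochner_Integration.integrable_add integrable_mult_right i integrable_Sr_quartic assms ft)
        (auto simp only: S norm_quartic_convex)
    finally show ?thesis .
  qed
  then have "(\<Sum>\<^sub>\<infinity>x. Sr_quartic f x + 4 * t * Re (Sr_cubic g f x)) \<le> Qr (\<lambda>x. f x + of_real t * g x)"
    unfolding Qr_def
    by (intro infsum_mono summable_on_add summable_on_cmult_right summable_on_Re
        Sr_quartic_summable Sr_cubic_summable assms ft)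
  also have "(\<Sum>\<^sub>\<infinity>x. Sr_quartic f x + 4 * t * Re (Sr_cubic g f x)) = Qr f + 4 * t * Re (Qd \<mu> g f f f)"
    unfolding Qr_def Qd_eq_infsum_cubic infsum_Re[OF Sr_cubic_summable[OF assms], symmetric]
      infsum_cmult_right'[symmetric]
    by (intro infsum_add summable_on_cmult_right summable_on_Re
        Sr_quartic_summable Sr_cubic_summable assms)
  finally show ?thesis .
qed

end

section \<open>Weak limits, the Euler--Lagrange equation and existence of maximizers\<close>

lemma l2_inner_tendsto:
  assumes f: "\<And>n. is_l2 (f n)" "\<And>n. l2_norm_sq (f n) = L" and g: "is_l2 g"
    and lim: "\<And>x. (\<lambda>n. f n x) \<longlonglongrightarrow> f' x"
  shows "(\<lambda>n. l2_inner g (f n)) \<longlonglongrightarrow> l2_inner g f'"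
  unfolding l2_inner_def
proof (rule infsum_tendsto_of_weighted_bound)
  show "(\<lambda>n. cnj (g x) * f n x) \<longlonglongrightarrow> cnj (g x) * f' x" for x
    by (intro tendsto_intros lim)
  show "(\<lambda>x. (norm (f n x))\<^sup>2) summable_on UNIV" for n
    using f(1) by (simp add: is_l2_def)
  show "(\<Sum>\<^sub>\<infinity>x. (norm (f n x))\<^sup>2) \<le> L" for n
    using f(2)[of n] by (simp add: l2_norm_sq_def)
qed (use g norm_cnj_mult_le in \<open>auto simp: is_l2_def\<close>)

text \<open>The two sides agree at \<open>t = 0\<close>, so their difference has a minimum there and
  its derivative \<open>4 * K * L * \<rho> - 4 * q\<close> vanishes.\<close>

lemma quadratic_tangent:
  fixes K L q \<rho> G :: real
  assumes "\<And>t. K * L\<^sup>2 + 4 * t * q \<le> K * (L + 2 * t * \<rho> + t\<^sup>2 * G)\<^sup>2"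
  shows "q = K * L * \<rho>"
proof -
  let ?\<phi> = "\<lambda>t. K * (L + 2 * t * \<rho> + t\<^sup>2 * G)\<^sup>2 - 4 * t * q"
  have "(?\<phi> has_real_derivative 4 * (K * L * \<rho>) - 4 * q) (at 0)"
    by (auto intro!: derivative_eq_intros)
  moreover have "\<forall>t. \<bar>0 - t\<bar> < 1 \<longrightarrow> ?\<phi> 0 \<le> ?\<phi> t"
    using assms by (auto simp: algebra_simps)
  ultimately have "4 * (K * L * \<rho>) - 4 * q = 0"
    by (rule DERIV_local_min[OF _ zero_less_one])
  then show ?thesis by simp
qed

context finite_real_measure
begin

text \<open>Excludes vanishing: bounded norm together with a small sup norm forces a small value of
  the form. Bounded support makes the growth factor \<open>exp (4 * \<bar>r\<bar>)\<close> at most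
  \<open>exp (4 * R)\<close> almost everywhere.\<close>

lemma Qr_le_sup:
  assumes "is_l2 h" "\<And>x. norm (h x) \<le> d" "emeasure \<mu> (UNIV - {-R..R}) = 0"
  shows "Qr h \<le> (exp (4 * R) * d)\<^sup>2 * (l2_norm_sq h * mass)"
proof (rule Qr_le_AE[OF assms(1)])
  fix x
  have d: "0 \<le> d" using assms(2)[of 0] norm_ge_zero order_trans by blast
  have "AE r in \<mu>. \<bar>r\<bar> \<le> R"
    by (rule AE_I[OF _ assms(3)]) (auto simp: sets_eq_borel)
  then show "AE r in \<mu>. (norm (Sr r h x))\<^sup>2 \<le> (exp (4 * R) * d)\<^sup>2"
  proof eventually_elim
    case (elim r)
    have "norm (Sr r h x) \<le> exp (4 * \<bar>r\<bar>) * d"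
      by (rule norm_Sr_le_exp[OF assms(2)])
    also have "\<dots> \<le> exp (4 * R) * d"
      using elim d by (intro mult_right_mono) auto
    finally show ?case by (intro power_mono) auto
  qed
qed simp

text \<open>Indicators of growing intervals converge pointwise to 1, and so do their evolutions at
  the origin, for every \<open>r\<close>. If all their quartic terms at 0 vanished, then 0 would
  tend to 1 for almost every \<open>r\<close>, which a nonzero measure forbids.\<close>

lemma ex_Qr_pos:
  assumes "mass > 0"
  shows "\<exists>h. is_l2 h \<and> Qr h > 0"
proof -
  define h where "h n x = (if \<bar>x\<bar> \<le> int n then 1 else 0 :: complex)" for n x
  have l2: "is_l2 (h n)" for n
  proof (rule is_l2_I)
    fix F :: "int set" assume "finite F"
    then have "(\<Sum>x\<in>F. (norm (h n x))\<^sup>2) \<le> (\<Sum>x\<in>F \<union> {- int n..int n}. (norm (h n x))\<^sup>2)"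
      by (intro sum_mono2) auto
    also have "\<dots> = (\<Sum>x\<in>{- int n..int n}. (norm (h n x))\<^sup>2)"
      using \<open>finite F\<close> by (intro sum.mono_neutral_right) (auto simp: h_def)
    finally show "(\<Sum>x\<in>F. (norm (h n x))\<^sup>2) \<le> (\<Sum>x\<in>{- int n..int n}. (norm (h n x))\<^sup>2)" .
  qed
  have lim: "(\<lambda>n. Sr r (h n) 0) \<longlonglongrightarrow> 1" for r
  proof -
    have "(\<lambda>n. Sr r (h n) 0) \<longlonglongrightarrow> Sr r (\<lambda>x. 1) 0"
    proof (rule Sr_tendsto[where M = 1])
      fix x :: int
      have "eventually (\<lambda>n. 1 = h n x) sequentially"
        using eventually_ge_at_top[of "nat \<bar>x\<bar>"] by eventually_elim (auto simp: h_def)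
      then show "(\<lambda>n. h n x) \<longlonglongrightarrow> 1"
        by (rule Lim_transform_eventually[OF tendsto_const])
    qed (simp add: h_def)
    then show ?thesis by (simp add: Sr_one)
  qed
  have "\<exists>n. Sr_quartic (h n) 0 > 0"
  proof (rule ccontr)
    assume "\<not> ?thesis"
    then have "Sr_quartic (h n) 0 = 0" for n
      using Sr_quartic_nonneg[of "h n" 0] by (meson antisym not_less)
    then have "AE r in \<mu>. norm (Sr r (h n) 0) ^ 4 = 0" for n
      unfolding Sr_quartic_def
      using integral_nonneg_eq_0_iff_AE[OF integrable_Sr_quartic[OF l2, of n 0]] by simp
    then have "AE r in \<mu>. \<forall>n. norm (Sr r (h n) 0) ^ 4 = 0"
      unfolding AE_all_countable by blast
    then have "AE r in \<mu>. False"
    proof eventually_elim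
      case (elim r)
      then have "(\<lambda>n. 0) \<longlonglongrightarrow> (1::complex)"
        using lim[of r] by simp
      then show ?case
        using LIMSEQ_unique[OF tendsto_const, of "0::complex" 1] by simp
    qed
    then have "mass = 0"
      by (auto simp: AE_iff_null measure_def null_sets_def)
    with assms show False by simp
  qed
  then obtain n where "Sr_quartic (h n) 0 > 0" ..
  moreover have "sum (Sr_quartic (h n)) {0} \<le> Qr (h n)"
    unfolding Qr_def by (intro finite_sum_le_infsum Sr_quartic_summable l2 Sr_quartic_nonneg) auto
  ultimately show ?thesis using l2[of n] by auto
qed

text \<open>For fixed \<open>t\<close>, the tangent at \<open>f n\<close> lies below the form at the
  perturbed sequence, hence below the quartic bound. The index \<open>n\<close> enters only through
  \<open>Qr (f n)\<close>, the constant norm and pairings with the fixed direction, all of which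
  converge. The limiting inequality has \<open>f'\<close> in the pairings but still \<open>L\<close>
  as squared norm, and \<open>quadratic_tangent\<close> equates the slopes.\<close>

lemma weak_limit_euler_lagrange:
  assumes K: "\<And>h. is_l2 h \<Longrightarrow> Qr h \<le> K * (l2_norm_sq h)\<^sup>2"
    and f: "\<And>n. is_l2 (f n)" "\<And>n. l2_norm_sq (f n) = L"
    and Q: "(\<lambda>n. Qr (f n)) \<longlonglongrightarrow> K * L\<^sup>2"
    and lim: "\<And>x. (\<lambda>n. f n x) \<longlonglongrightarrow> f' x"
    and g: "is_l2 g"
  shows "of_real (K * L) * l2_inner g f' = Qd \<mu> g f' f' f'"
proof -
  have f': "is_l2 f'"
    by (rule is_l2_pointwise_limit[of f "\<lambda>_. L" L]) (simp_all add: f lim)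
  have Re: "Re (Qd \<mu> u f' f' f') = K * L * Re (l2_inner u f')" if u: "is_l2 u" for u
  proof (rule quadratic_tangent)
    fix t
    show "K * L\<^sup>2 + 4 * t * Re (Qd \<mu> u f' f' f')
       \<le> K * (L + 2 * t * Re (l2_inner u f') + t\<^sup>2 * l2_norm_sq u)\<^sup>2"
    proof (rule LIMSEQ_le)
      show "(\<lambda>n. Qr (f n) + 4 * t * Re (Qd \<mu> u (f n) (f n) (f n)))
          \<longlonglongrightarrow> K * L\<^sup>2 + 4 * t * Re (Qd \<mu> u f' f' f')"
        by (intro tendsto_intros Q Qd_tendsto[OF f u lim])
      show "(\<lambda>n. K * (L + 2 * t * Re (l2_inner u (f n)) + t\<^sup>2 * l2_norm_sq u)\<^sup>2)
          \<longlonglongrightarrow> K * (L + 2 * t * Re (l2_inner u f') + t\<^sup>2 * l2_norm_sq u)\<^sup>2"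
        by (intro tendsto_intros l2_inner_tendsto[OF f u lim])
      have "Qr (f n) + 4 * t * Re (Qd \<mu> u (f n) (f n) (f n))
          \<le> K * (L + 2 * t * Re (l2_inner u (f n)) + t\<^sup>2 * l2_norm_sq u)\<^sup>2" for n
        using Qr_convex[OF f(1)[of n] u, of t] K[OF l2_norm_sq_add(1)[OF f(1)[of n] u, of t]]
        unfolding l2_norm_sq_add(2)[OF f(1) u] f(2) by linarith
      then show "\<exists>N. \<forall>n\<ge>N. Qr (f n) + 4 * t * Re (Qd \<mu> u (f n) (f n) (f n))
          \<le> K * (L + 2 * t * Re (l2_inner u (f n)) + t\<^sup>2 * l2_norm_sq u)\<^sup>2" by blast
    qed
  qed
  \<comment> \<open>Both sides are conjugate-linear in \<open>g\<close>, so testing with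
    \<open>\<i> * g\<close> turns the equation for real parts into the one for imaginary
    parts.\<close>
  have inner: "l2_inner (\<lambda>x. \<i> * g x) f' = - \<i> * l2_inner g f'"
    unfolding l2_inner_def by (simp add: infsum_cmult_right' mult.assoc infsum_uminus)
  show ?thesis
    using Re[OF g] Re[OF l2_norm_sq_scale(1)[OF g, of \<i>]]
    unfolding inner Qd_scale[OF g] by (simp add: complex_eq_iff)
qed

lemma ex_maximizer:
  assumes K: "\<And>h. is_l2 h \<Longrightarrow> Qr h \<le> K * (l2_norm_sq h)\<^sup>2"
    and sup: "\<And>y. y < K * L\<^sup>2 \<Longrightarrow> \<exists>h. is_l2 h \<and> l2_norm_sq h = L \<and> y < Qr h"
    and pos: "K > 0" "L > 0" "mass > 0"
    and supp: "emeasure \<mu> (UNIV - {-R..R}) = 0"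
  shows "\<exists>f. is_l2 f \<and> l2_norm_sq f = L \<and> Qr f = K * L\<^sup>2"
proof -
  define P where "P = K * L\<^sup>2"
  have P: "P > 0" using pos by (simp add: P_def)
  \<comment> \<open>With \<open>n + 2\<close> in the denominator every value already exceeds
    \<open>P / 2\<close>, so the lower bound on the sup norm holds for all \<open>n\<close>.\<close>
  have "\<exists>h. is_l2 h \<and> l2_norm_sq h = L \<and> P - P / real (n + 2) < Qr h" for n
    using sup[of "P - P / real (n + 2)"] P by (simp add: P_def)
  then obtain h where h: "\<And>n. is_l2 (h n)" "\<And>n. l2_norm_sq (h n) = L"
      "\<And>n. P - P / real (n + 2) < Qr (h n)"
    by metis
  have hP: "Qr (h n) \<le> P" for n
    using K[OF h(1), of n] by (simp add: h(2) P_def)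
  have Plim: "(\<lambda>n. Qr (h n)) \<longlonglongrightarrow> P"
  proof (rule tendsto_sandwich[where h = "\<lambda>_. P"])
    have "(\<lambda>n. P - P / real (n + 2)) \<longlonglongrightarrow> P - 0"
      by (intro tendsto_intros LIMSEQ_ignore_initial_segment[OF lim_const_over_n])
    then show "(\<lambda>n. P - P / real (n + 2)) \<longlonglongrightarrow> P" by simp
  qed (use h(3) hP in \<open>auto intro!: always_eventually less_imp_le\<close>)
  \<comment> \<open>Chosen so that the bound of \<open>Qr_le_sup\<close> for sequences of sup norm
    at most \<open>c\<close> is exactly \<open>P / 2\<close>.\<close>
  define c where "c = sqrt (P / (2 * (L * mass))) / exp (4 * R)"
  have c: "c > 0" using P pos by (simp add: c_def)
  have cP: "(exp (4 * R) * c)\<^sup>2 * (L * mass) = P / 2"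
    using P pos by (simp add: c_def)
  have "\<exists>x. c < norm (h n x)" for n
  proof (rule ccontr)
    assume "\<not> ?thesis"
    then have "Qr (h n) \<le> P / 2"
      using Qr_le_sup[OF h(1)[of n] _ supp, of c] by (simp add: h(2) cP not_less)
    moreover have "P / real (n + 2) \<le> P / 2"
      using P by (intro divide_left_mono) auto
    ultimately show False using h(3)[of n] by linarith
  qed
  then obtain a where a: "\<And>n. c < norm (h n (a n))" by metis
  \<comment> \<open>Translation puts a value larger than \<open>c\<close> at the origin, where it
    survives the pointwise limit; norm and form are unchanged.\<close>
  define u where "u n x = h n (x + a n)" for n x
  have u: "is_l2 (u n)" "l2_norm_sq (u n) = L" "Qr (u n) = Qr (h n)" for n
    using l2_norm_sq_shift[OF h(1)[of n], of "a n"] Qr_shift[of "h n" "a n"]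
    by (auto simp: u_def[abs_def] h(2))
  \<comment> \<open>All sites share the bound \<open>sqrt L\<close>, so a diagonal argument over the
    countably many sites gives pointwise convergence.\<close>
  obtain k where k: "strict_mono (k :: nat \<Rightarrow> nat)" "\<And>x. x \<in> UNIV \<Longrightarrow> \<exists>l. (\<lambda>n. u (k n) x) \<longlonglongrightarrow> l"
    using function_convergent_subsequence[of UNIV u "sqrt L"] norm_le_sqrt_l2_norm_sq[OF u(1)] u(2)
    by (metis countableI_type)
  from k(2) obtain f where f: "\<And>x. (\<lambda>n. u (k n) x) \<longlonglongrightarrow> f x"
    by (metis UNIV_I)
  have f_l2: "is_l2 f" "l2_norm_sq f \<le> L"
    using is_l2_pointwise_limit[OF u(1) _ tendsto_const f, of L] u(2) by auto
  have "c \<le> norm (f 0)"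
    by (rule LIMSEQ_le_const[OF tendsto_norm[OF f]]) (use a in \<open>auto simp: u_def intro: less_imp_le\<close>)
  then have "0 < (norm (f 0))\<^sup>2" using c by (auto intro!: zero_less_power)
  then have f_pos: "l2_norm_sq f > 0"
    using norm_sq_le_l2_norm_sq[OF f_l2(1), of 0] by linarith
  have Plim': "(\<lambda>n. Qr (u (k n))) \<longlonglongrightarrow> K * L\<^sup>2"
    using LIMSEQ_subseq_LIMSEQ[OF Plim k(1)] unfolding u(3) P_def o_def .
  \<comment> \<open>Testing with \<open>f\<close> itself shows that no mass was lost: the factor on
    the left is the full \<open>L\<close>, and one power of the positive norm of \<open>f\<close>
    cancels against the quartic bound.\<close>
  have "of_real (K * L) * l2_inner f f = Qd \<mu> f f f f"
    by (rule weak_limit_euler_lagrange[OF K u(1,2) Plim' f f_l2(1)])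
  then have eq: "K * L * l2_norm_sq f = Qr f"
    unfolding l2_inner_self[OF f_l2(1)] Qd_self_eq_Qr[OF f_l2(1)] of_real_mult[symmetric] of_real_eq_iff .
  also have "\<dots> \<le> K * (l2_norm_sq f)\<^sup>2" by (rule K[OF f_l2(1)])
  finally have "L \<le> l2_norm_sq f"
    using f_pos pos by (simp add: power2_eq_square)
  then have "l2_norm_sq f = L" using f_l2(2) by simp
  then show ?thesis using eq f_l2(1) by (auto simp: power2_eq_square)
qed

section \<open>The supremum as a finite positive real number\<close>

lemma Pd_eq_ennreal: "Pd \<mu> L = ennreal (enn2real (Pd \<mu> L))"
  and Pd_finite: "Pd \<mu> L < \<infinity>"
proof -
  have "Pd \<mu> L \<le> ennreal (L * (L * mass))"
    unfolding Pd_def by (rule SUP_least) (use Qr_le in \<open>auto simp: Qd_diag_eq_Qr intro!: ennreal_leI\<close>)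
  then show "Pd \<mu> L < \<infinity>" by (simp add: order_le_less_trans)
  then show "Pd \<mu> L = ennreal (enn2real (Pd \<mu> L))" by simp
qed

text \<open>Rescaling \<open>h\<close> to squared norm \<open>L\<close> makes it a competitor in the
  supremum, and the form is homogeneous of degree 4. A sequence of norm zero cannot be rescaled;
  there \<open>Qr_le\<close> gives the claim.\<close>

lemma Qr_le_Pd:
  assumes L: "L > 0" and "is_l2 h"
  shows "Qr h \<le> enn2real (Pd \<mu> L) / L\<^sup>2 * (l2_norm_sq h)\<^sup>2"
proof (cases "l2_norm_sq h = 0")
  case True
  then show ?thesis using Qr_le[OF assms(2)] by simp
next
  case False
  then have N: "l2_norm_sq h > 0" using l2_norm_sq_nonneg[of h] by simp
  define c where "c = sqrt (L / l2_norm_sq h)"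
  have c: "c \<ge> 0" "c\<^sup>2 = L / l2_norm_sq h" using N L by (auto simp: c_def)
  have c4: "c ^ 4 = (L / l2_norm_sq h)\<^sup>2" unfolding c(2)[symmetric] by (simp flip: power_mult)
  let ?h = "\<lambda>x. of_real c * h x"
  have "is_l2 ?h" "l2_norm_sq ?h = L"
    using l2_norm_sq_scale[OF assms(2), of "of_real c"] c N by auto
  then have "Qd_diag \<mu> ?h \<le> Pd \<mu> L"
    unfolding Pd_def by (intro SUP_upper) auto
  then have "ennreal (Qr ?h) \<le> ennreal (enn2real (Pd \<mu> L))"
    using Pd_eq_ennreal[of L] Qd_diag_eq_Qr[OF \<open>is_l2 ?h\<close>] by simp
  then have "Qr ?h \<le> enn2real (Pd \<mu> L)" by simp
  then have "c ^ 4 * Qr h \<le> enn2real (Pd \<mu> L)"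
    using Qr_scale[OF assms(2), of "of_real c"] c by simp
  then show ?thesis using N L unfolding c4 by (simp add: field_simps)
qed

lemma Pd_pos:
  assumes "L > 0" "mass > 0"
  shows "enn2real (Pd \<mu> L) > 0"
proof -
  obtain h where h: "is_l2 h" "Qr h > 0" using ex_Qr_pos[OF assms(2)] by blast
  then have "0 < enn2real (Pd \<mu> L) / L\<^sup>2 * (l2_norm_sq h)\<^sup>2"
    using Qr_le_Pd[OF assms(1) h(1)] by linarith
  then have "enn2real (Pd \<mu> L) \<noteq> 0" by auto
  then show ?thesis using enn2real_nonneg[of "Pd \<mu> L"] by linarith
qed

text \<open>Translates the approximation property of the supremum to the reals. Since
  \<open>ennreal\<close> sends a negative \<open>y\<close> to 0, positivity of the supremum covers
  that case.\<close>

lemma ex_Qr_near_Pd: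
  assumes "y < enn2real (Pd \<mu> L)" "0 < enn2real (Pd \<mu> L)"
  shows "\<exists>h. is_l2 h \<and> l2_norm_sq h = L \<and> y < Qr h"
proof -
  have "ennreal y < Pd \<mu> L"
    using assms by (subst Pd_eq_ennreal) (simp add: ennreal_less_iff ennreal_lessI)
  then obtain h where "is_l2 h" "l2_norm_sq h = L" "ennreal y < Qd_diag \<mu> h"
    unfolding Pd_def less_SUP_iff by auto
  moreover from this have "y < Qr h"
    using Qr_nonneg[of h] by (simp add: Qd_diag_eq_Qr ennreal_less_iff) (metis ennreal_leI not_less)
  ultimately show ?thesis by blast
qed

end

theorem theorem1p2:
  fixes \<mu> :: "real measure"
  assumes borel: "sets \<mu> = sets borel"
    and bounded: "emeasure \<mu> UNIV < \<infinity>"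
    and nonzero: "emeasure \<mu> UNIV \<noteq> 0"
  shows "(\<forall>lam>0. Pd \<mu> lam < \<infinity>)
    \<and> ((\<exists>R. emeasure \<mu> (UNIV - {-R..R}) = 0) \<longrightarrow>
        (\<forall>lam>0.
          (\<exists>f. is_l2 f \<and> l2_norm_sq f = lam \<and> Qd_diag \<mu> f = Pd \<mu> lam) \<and>
          (\<forall>f. is_l2 f \<and> l2_norm_sq f = lam \<and> Qd_diag \<mu> f = Pd \<mu> lam \<longrightarrow>
             (let \<omega> = enn2real (Pd \<mu> lam) / lam in
               \<omega> > 0 \<and>
               Qd \<mu> f f f f = complex_of_real (enn2real (Pd \<mu> lam)) \<and>
               (\<forall>g. is_l2 g \<longrightarrow>
                  complex_of_real \<omega> * l2_inner g f = Qd \<mu> g f f f)))))"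
proof -
  have space: "space \<mu> = UNIV"
    using sets_eq_imp_space_eq[OF borel] by simp
  interpret finite_real_measure \<mu>
    by (intro finite_real_measure.intro finite_real_measure_axioms.intro finite_measureI borel)
      (use bounded in \<open>simp add: space\<close>)
  have mass: "mass > 0"
    using nonzero by (simp add: space emeasure_eq_measure zero_less_measure_iff)
  have max: "\<exists>f. is_l2 f \<and> l2_norm_sq f = lam \<and> Qd_diag \<mu> f = Pd \<mu> lam"
    if supp: "emeasure \<mu> (UNIV - {-R..R}) = 0" and lam: "lam > 0" for R lam
  proof -
    let ?P = "enn2real (Pd \<mu> lam)"
    have P: "?P > 0" by (rule Pd_pos[OF lam mass])
    \<comment> \<open>The quartic bound has the constant \<open>K = ?P / lam^2\<close>, for which
      the value \<open>K * L^2\<close> in \<open>ex_maximizer\<close> is the supremum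
      itself.\<close>
    have K: "?P / lam\<^sup>2 * lam\<^sup>2 = ?P" using lam by simp
    have "\<exists>f. is_l2 f \<and> l2_norm_sq f = lam \<and> Qr f = ?P / lam\<^sup>2 * lam\<^sup>2"
      by (rule ex_maximizer[OF Qr_le_Pd[OF lam] _ _ lam mass supp])
        (use P lam ex_Qr_near_Pd in \<open>simp_all add: K\<close>)
    then obtain f where "is_l2 f" "l2_norm_sq f = lam" "Qr f = ?P" unfolding K by blast
    then show ?thesis using Qd_diag_eq_Qr Pd_eq_ennreal[of lam] by metis
  qed
  have EL: "enn2real (Pd \<mu> lam) / lam > 0 \<and>
      Qd \<mu> f f f f = complex_of_real (enn2real (Pd \<mu> lam)) \<and>
      (\<forall>g. is_l2 g \<longrightarrow> complex_of_real (enn2real (Pd \<mu> lam) / lam) * l2_inner g f = Qd \<mu> g f f f)"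
    if lam: "lam > 0" and f: "is_l2 f" "l2_norm_sq f = lam" "Qd_diag \<mu> f = Pd \<mu> lam" for lam f
  proof -
    let ?P = "enn2real (Pd \<mu> lam)"
    have Q: "Qr f = ?P"
      using f(3) Qr_nonneg[of f] unfolding Qd_diag_eq_Qr[OF f(1)] by (metis enn2real_ennreal)
    \<comment> \<open>A constant sequence is its own pointwise limit, so the weak-limit equation
      applies to any maximizer; its factor \<open>K * L\<close> equals \<omega>.\<close>
    have "(\<lambda>n. Qr f) \<longlonglongrightarrow> ?P / lam\<^sup>2 * lam\<^sup>2"
      using lam by (simp add: Q)
    from weak_limit_euler_lagrange[OF Qr_le_Pd[OF lam] f(1,2) this tendsto_const]
    have "of_real (?P / lam\<^sup>2 * lam) * l2_inner g f = Qd \<mu> g f f f" if "is_l2 g" for g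
      using that by blast
    moreover have "?P / lam\<^sup>2 * lam = ?P / lam" using lam by (simp add: power2_eq_square)
    ultimately have "\<forall>g. is_l2 g \<longrightarrow> of_real (?P / lam) * l2_inner g f = Qd \<mu> g f f f"
      by (simp only:) blast
    moreover have "?P / lam > 0" using Pd_pos[OF lam mass] lam by simp
    ultimately show ?thesis
      using Qd_self_eq_Qr[OF f(1)] unfolding Q by blast
  qed
  show ?thesis
    unfolding Let_def using Pd_finite max EL by blast
qed

end
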